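(* Let $m<n$, let $A\in\mathbb{R}^{m\times n}$ have full rank, and let $b\in\mathbb{R}^m$. Let $\mathcal{G}=(\mathcal{V},\mathcal{E})$ be a connected undirected simple graph with node set $\mathcal{V}=\{1,\dots,P\}$, $P\ge 2$, and let $A$ and $b$ be partitioned by rows into blocks $A_p\in\mathbb{R}^{m_p\times n}$, $b_p\in\mathbb{R}^{m_p}$, $p=1,\dots,P$, with $m_1+\cdots+m_P=m$. Let $\rho>0$. Assume that $\mathcal{G}$ is bipartite, with $\mathcal{V}$ the disjoint union of two color classes $\mathcal{C}_1,\mathcal{C}_2$ such that no two nodes in the same class are adjacent. Then, for every $p\in\mathcal{V}$, the sequence $\{x_p^{(k)}\}_{k\ge 1}$ produced by the D-ADMM algorithm for bipartite graphs (described in the context) converges to a solution of the Basis Pursuit problem $$\text{minimize } \|x\|_1\quad\text{subject to } Ax=b,\qquad x\in\mathbb{R}^n .$$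
   Context: $\|x\|_1=|x_1|+\cdots+|x_n|$ is the $\ell_1$ norm and $\|\cdot\|$ is the Euclidean norm. Row partition means $A=[A_1^\top\ \cdots\ A_P^\top]^\top$ and $b=[b_1^\top\ \cdots\ b_P^\top]^\top$, where each $A_p$ consists of $m_p$ rows of $A$. For a node $p$, $\mathcal{N}_p$ denotes its set of neighbors in $\mathcal{G}$ and $D_p=|\mathcal{N}_p|$ its degree. D-ADMM for bipartite graphs (run indefinitely). Initialization: for all $p\in\mathcal{V}$, $\gamma_p^{(1)}=0\in\mathbb{R}^n$ and $x_p^{(1)}=0\in\mathbb{R}^n$. For $k=1,2,\dots$: 1. For all $p\in\mathcal{C}_1$ set $v_p^{(k)}=\gamma_p^{(k)}-\rho\sum_{j\in\mathcal{N}_p}x_j^{(k)}$ and $$x_p^{(k+1)}=\arg\min_{x_p\in\mathbb{R}^n}\Bigl\{\tfrac1P\|x_p\|_1+(v_p^{(k)})^\top x_p+\tfrac{D_p\rho}{2}\|x_p\|^2 \ :\ A_px_p=b_p\Bigr\}.$$ 2. For all $p\in\mathcal{C}_2$ set $v_p^{(k)}=\gamma_p^{(k)}-\rho\sum_{j\in\mathcal{N}_p}x_j^{(k+1)}$ and define $x_p^{(k+1)}$ by the same minimization formula as in step 1 (with this $v_p^{(k)}$). 3. For all $p\in\mathcal{V}$ set $\gamma_p^{(k+1)}=\gamma_p^{(k)}+\rho\sum_{j\in\mathcal{N}_p}\bigl(x_p^{(k+1)}-x_j^{(k+1)}\bigr)$. *)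

theory Defs
  imports
    "HOL-Analysis.Analysis"
    "Graph_Theory.Digraph_Component"
    "Graph_Theory.Pair_Digraph"
begin

definition l1_norm :: "real ^ 'n::finite \<Rightarrow> real" where
  "l1_norm x = (\<Sum>i\<in>UNIV. \<bar>x $ i\<bar>)"

definition bp_solution :: "real ^ 'n ^ 'm \<Rightarrow> real ^ 'm \<Rightarrow> real ^ 'n \<Rightarrow> bool" where
  "bp_solution A b x \<longleftrightarrow> is_arg_min l1_norm (\<lambda>z. A *v z = b) x"

definition neighbors :: "'v pair_pre_digraph \<Rightarrow> 'v \<Rightarrow> 'v set" where
  "neighbors G p = {j. (p, j) \<in> parcs G}"

definition proper_2_coloring :: "'v pair_pre_digraph \<Rightarrow> 'v set \<Rightarrow> 'v set \<Rightarrow> bool" where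
  "proper_2_coloring G C1 C2 \<longleftrightarrow>
     C1 \<union> C2 = pverts G \<and> C1 \<inter> C2 = {} \<and>
     (\<forall>p\<in>C1. \<forall>q\<in>C1. (p, q) \<notin> parcs G) \<and>
     (\<forall>p\<in>C2. \<forall>q\<in>C2. (p, q) \<notin> parcs G)"

text \<open>
  The blocks \<open>A\<^sub>p\<close> have different numbers of rows, so they are not matrices of one type.
  A partition of the rows is given by the index sets \<open>R p\<close> of the rows of \<open>A\<close> and \<open>b\<close> that
  belong to block \<open>p\<close>; thus \<open>m\<^sub>p\<close> is the cardinality of \<open>R p\<close>, and the \<open>m\<^sub>p\<close> add up to \<open>m\<close>.
\<close>

definition row_partition :: "'v set \<Rightarrow> ('v \<Rightarrow> 'm set) \<Rightarrow> bool" where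
  "row_partition V R \<longleftrightarrow> disjoint_family_on R V \<and> (\<Union>p\<in>V. R p) = UNIV"

text \<open>The set of \<open>z\<close> with \<open>A\<^sub>p z = b\<^sub>p\<close>.\<close>

definition block_solutions ::
  "real ^ 'n ^ 'm \<Rightarrow> real ^ 'm \<Rightarrow> ('v \<Rightarrow> 'm set) \<Rightarrow> 'v \<Rightarrow> (real ^ 'n) set" where
  "block_solutions A b R p = {z. \<forall>i\<in>R p. row i A \<bullet> z = b $ i}"

definition local_objective ::
  "'v pair_pre_digraph \<Rightarrow> real \<Rightarrow> 'v \<Rightarrow> real ^ 'n \<Rightarrow> real ^ 'n \<Rightarrow> real" where
  "local_objective G \<rho> p v z =
     1 / real (card (pverts G)) * l1_norm z + v \<bullet> z
       + real (card (neighbors G p)) * \<rho> / 2 * (norm z)\<^sup>2"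

definition node_update ::
  "'v pair_pre_digraph \<Rightarrow> real ^ 'n ^ 'm \<Rightarrow> real ^ 'm \<Rightarrow> ('v \<Rightarrow> 'm set) \<Rightarrow> real
     \<Rightarrow> 'v \<Rightarrow> real ^ 'n \<Rightarrow> real ^ 'n" where
  "node_update G A b R \<rho> p v = arg_min_on (local_objective G \<rho> p v) (block_solutions A b R p)"

text \<open>
  \<open>x p k\<close> and \<open>\<gamma> p k\<close> are the values held by node \<open>p\<close> at iteration \<open>k \<ge> 1\<close>. Values at
  \<open>k = 0\<close> or at non-nodes are unconstrained and never used.
\<close>

definition bipartite_dadmm ::
  "'v pair_pre_digraph \<Rightarrow> 'v set \<Rightarrow> 'v set \<Rightarrow> real ^ 'n ^ 'm \<Rightarrow> real ^ 'm \<Rightarrow> ('v \<Rightarrow> 'm set)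
     \<Rightarrow> real \<Rightarrow> ('v \<Rightarrow> nat \<Rightarrow> real ^ 'n) \<Rightarrow> ('v \<Rightarrow> nat \<Rightarrow> real ^ 'n) \<Rightarrow> bool" where
  "bipartite_dadmm G C1 C2 A b R \<rho> x \<gamma> \<longleftrightarrow>
     (\<forall>p\<in>pverts G. \<gamma> p 1 = 0 \<and> x p 1 = 0) \<and>
     (\<forall>k\<ge>1.
        (\<forall>p\<in>C1. x p (k + 1) =
           node_update G A b R \<rho> p (\<gamma> p k - \<rho> *\<^sub>R (\<Sum>j\<in>neighbors G p. x j k))) \<and>
        (\<forall>p\<in>C2. x p (k + 1) =
           node_update G A b R \<rho> p (\<gamma> p k - \<rho> *\<^sub>R (\<Sum>j\<in>neighbors G p. x j (k + 1)))) \<and>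
        (\<forall>p\<in>pverts G. \<gamma> p (k + 1) =
           \<gamma> p k + \<rho> *\<^sub>R (\<Sum>j\<in>neighbors G p. x p (k + 1) - x j (k + 1))))"

end

theory Submission
  imports Defs
begin

text \<open>
  D-ADMM is the alternating direction method of multipliers for the problem of minimizing
  \<open>\<Sum>p. \<parallel>x\<^sub>p\<parallel>\<^sub>1 / P\<close> over copies \<open>x\<^sub>p\<close> with \<open>A\<^sub>p x\<^sub>p = b\<^sub>p\<close> that have to agree along the edges.
  Orient every edge from \<open>C1\<close> to \<open>C2\<close> and give it the multiplier
  \<open>L\<^sub>e = \<rho> \<Sum>i (x\<^sub>p\<^sup>i - x\<^sub>q\<^sup>i)\<close>, \<open>e = (p, q)\<close>. The vector \<open>\<gamma>\<^sub>p\<close> kept by a node is the net flow of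
  \<open>L\<close> out of \<open>p\<close>, and the optimality condition of the update of \<open>p\<close> says that the new \<open>x\<^sub>p\<close>
  minimizes \<open>\<parallel>z\<parallel>\<^sub>1 / P + s \<bullet> z\<close> over the block, where the slope \<open>s\<close> is this net flow plus, at
  the nodes of \<open>C1\<close>, the term \<open>\<rho> \<Sum>q (x\<^sub>q\<^sup>k\<^sup>+\<^sup>1 - x\<^sub>q\<^sup>k)\<close>, since those nodes have to work with old
  values of their neighbours (\<open>dadmm_is_edge_admm\<close>).

  Call \<open>(z, M)\<close> a saddle point if \<open>z\<close> is such a minimizer at every node for the slopes given by
  the net flow of \<open>M\<close>. Monotonicity of the minimizers in the slope makes the energy
  \<open>\<Sum>e. \<parallel>L\<^sub>e - M\<^sub>e\<parallel>\<^sup>2 / \<rho> + \<rho> \<parallel>x\<^sub>q - z\<parallel>\<^sup>2\<close> decrease by at least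
  \<open>\<rho> \<Sum>e (\<parallel>x\<^sub>p - x\<^sub>q\<parallel>\<^sup>2 + \<parallel>x\<^sub>q - old x\<^sub>q\<parallel>\<^sup>2)\<close> in each step after the first (\<open>energy_descent\<close>). Hence the copies
  agree asymptotically and all quantities stay bounded. A cluster point of the iteration is again
  a saddle point (\<open>saddle_cluster_point\<close>). The energy measured from that saddle point is
  decreasing and tends to 0 along a subsequence, so it tends to 0, and the whole sequence
  converges (\<open>converges_to_saddle\<close>).

  Net flows sum to 0 over the nodes. So adding up the minimality conditions of a saddle point
  shows that \<open>z\<close> solves Basis Pursuit (\<open>balanced_minimizer_is_bp_solution\<close>). Some saddle point
  has to exist for the energy argument to start: a solution of Basis Pursuit has a Lagrange
  multiplier because \<open>A\<close> is surjective, the multiplier yields slopes for the nodes that sum to 0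
  (\<open>bp_multipliers_exist\<close>), and on a connected graph all such families are net flows
  (\<open>balanced_flow_exists\<close>).
\<close>

section \<open>Minimizers of linearly perturbed functions\<close>

text \<open>
  Equivalently, \<open>- s\<close> is a subgradient at \<open>u\<close> of the restriction of \<open>F\<close> to \<open>S\<close>.
\<close>

definition tilted_minimizer ::
  "('a::real_inner \<Rightarrow> real) \<Rightarrow> 'a set \<Rightarrow> 'a \<Rightarrow> 'a \<Rightarrow> bool" where
  "tilted_minimizer F S s u \<longleftrightarrow> u \<in> S \<and> (\<forall>z\<in>S. F u + s \<bullet> u \<le> F z + s \<bullet> z)"

text \<open>
  Each of the two points competes in the minimization of the other one; the values of \<open>F\<close> cancel
  when the two inequalities are added. This is the monotonicity of subdifferentials.
\<close>

lemma tilted_minimizer_monotone: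
  assumes "tilted_minimizer F S s u" and "tilted_minimizer F S s' u'"
  shows "(s - s') \<bullet> (u - u') \<le> 0"
proof -
  have "F u + s \<bullet> u \<le> F u' + s \<bullet> u'" "F u' + s' \<bullet> u' \<le> F u + s' \<bullet> u"
    using assms unfolding tilted_minimizer_def by blast+
  then show ?thesis by (simp add: algebra_simps)
qed

lemma tilted_minimizer_limit:
  fixes u s :: "nat \<Rightarrow> 'a::real_inner"
  assumes "\<And>k. tilted_minimizer F S (s k) (u k)"
    and "closed S" and F: "continuous_on UNIV F"
    and s: "s \<longlonglongrightarrow> s'" and u: "u \<longlonglongrightarrow> u'"
  shows "tilted_minimizer F S s' u'"
  unfolding tilted_minimizer_def
proof (intro conjI ballI)
  show "u' \<in> S"
    using closed_sequentially[OF \<open>closed S\<close> _ u] assms(1) by (auto simp: tilted_minimizer_def)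
next
  fix z assume "z \<in> S"
  have Fu: "(\<lambda>k. F (u k)) \<longlonglongrightarrow> F u'"
    using continuous_on_tendsto_compose[OF F u] by simp
  have "(\<lambda>k. F (u k) + s k \<bullet> u k) \<longlonglongrightarrow> F u' + s' \<bullet> u'"
    by (intro tendsto_intros Fu s u)
  moreover have "(\<lambda>k. F z + s k \<bullet> z) \<longlonglongrightarrow> F z + s' \<bullet> z"
    by (intro tendsto_intros s)
  moreover have "F (u k) + s k \<bullet> u k \<le> F z + s k \<bullet> z" for k
    using assms(1) \<open>z \<in> S\<close> unfolding tilted_minimizer_def by blast
  ultimately show "F u' + s' \<bullet> u' \<le> F z + s' \<bullet> z"
    by (intro LIMSEQ_le) auto
qed

section \<open>Flows on directed edges\<close>

definition net_flow :: "('v \<times> 'v) set \<Rightarrow> ('v \<times> 'v \<Rightarrow> 'a::real_vector) \<Rightarrow> 'v \<Rightarrow> 'a" where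
  "net_flow E M v = (\<Sum>e | e \<in> E \<and> fst e = v. M e) - (\<Sum>e | e \<in> E \<and> snd e = v. M e)"

lemma net_flow_add: "net_flow E (\<lambda>e. M e + N e) v = net_flow E M v + net_flow E N v"
  and net_flow_diff: "net_flow E (\<lambda>e. M e - N e) v = net_flow E M v - net_flow E N v"
  and net_flow_zero: "net_flow E (\<lambda>e. 0) v = 0"
  and net_flow_scaleR: "net_flow E (\<lambda>e. c *\<^sub>R M e) v = c *\<^sub>R net_flow E M v"
  by (simp_all add: net_flow_def sum.distrib sum_subtractf algebra_simps scaleR_sum_right)

lemma net_flow_tendsto:
  fixes M :: "'v \<times> 'v \<Rightarrow> nat \<Rightarrow> 'a::real_normed_vector"
  assumes "\<And>e. e \<in> E \<Longrightarrow> M e \<longlonglongrightarrow> M' e"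
  shows "(\<lambda>k. net_flow E (\<lambda>e. M e k) v) \<longlonglongrightarrow> net_flow E M' v"
  unfolding net_flow_def using assms by (intro tendsto_intros) auto

lemma sum_incident_inner:
  fixes a :: "'v \<times> 'v \<Rightarrow> 'a::real_inner"
  assumes "finite V" "E \<subseteq> V \<times> V"
  shows "(\<Sum>v\<in>V. (\<Sum>e | e \<in> E \<and> fst e = v. a e) \<bullet> y v) = (\<Sum>e\<in>E. a e \<bullet> y (fst e))"
    and "(\<Sum>v\<in>V. (\<Sum>e | e \<in> E \<and> snd e = v. a e) \<bullet> y v) = (\<Sum>e\<in>E. a e \<bullet> y (snd e))"
proof -
  have fin: "finite E" using assms by (meson finite_SigmaI finite_subset)
  have "(\<Sum>v\<in>V. (\<Sum>e | e \<in> E \<and> f e = v. a e) \<bullet> y v) = (\<Sum>e\<in>E. a e \<bullet> y (f e))"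
    if "f ` E \<subseteq> V" for f :: "'v \<times> 'v \<Rightarrow> 'v"
  proof -
    have "(\<Sum>e\<in>E. a e \<bullet> y (f e)) = (\<Sum>v\<in>V. \<Sum>e | e \<in> E \<and> f e = v. a e \<bullet> y (f e))"
      using sum.group[OF fin assms(1) that, of "\<lambda>e. a e \<bullet> y (f e)"] by simp
    also have "\<dots> = (\<Sum>v\<in>V. (\<Sum>e | e \<in> E \<and> f e = v. a e) \<bullet> y v)"
      by (auto simp: inner_sum_left intro!: sum.cong)
    finally show ?thesis by simp
  qed
  from this[of fst] this[of snd] assms(2)
  show "(\<Sum>v\<in>V. (\<Sum>e | e \<in> E \<and> fst e = v. a e) \<bullet> y v) = (\<Sum>e\<in>E. a e \<bullet> y (fst e))"
    and "(\<Sum>v\<in>V. (\<Sum>e | e \<in> E \<and> snd e = v. a e) \<bullet> y v) = (\<Sum>e\<in>E. a e \<bullet> y (snd e))"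
    by fastforce+
qed

text \<open>
  Summation by parts: the net flow is the adjoint of the map that takes node potentials to their
  differences along the edges. This turns sums of optimality conditions over the nodes into
  sums over the edges.
\<close>

lemma sum_net_flow_inner:
  fixes M :: "'v \<times> 'v \<Rightarrow> 'a::real_inner"
  assumes "finite V" "E \<subseteq> V \<times> V"
  shows "(\<Sum>v\<in>V. net_flow E M v \<bullet> y v) = (\<Sum>e\<in>E. M e \<bullet> (y (fst e) - y (snd e)))"
  unfolding net_flow_def inner_diff_left sum_subtractf sum_incident_inner[OF assms]
  by (simp add: inner_diff_right sum_subtractf)

lemma sum_net_flow:
  fixes M :: "'v \<times> 'v \<Rightarrow> 'a::real_inner"
  assumes "finite V" "E \<subseteq> V \<times> V"
  shows "(\<Sum>v\<in>V. net_flow E M v) = 0"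
proof -
  have "(\<Sum>v\<in>V. net_flow E M v) \<bullet> y = 0" for y
    using sum_net_flow_inner[OF assms, of M "\<lambda>_. y"] by (simp add: inner_sum_left)
  then show ?thesis using inner_eq_zero_iff by blast
qed

section \<open>Alternating minimization with edge multipliers\<close>

lemma common_convergent_subsequence:
  fixes f :: "'i \<Rightarrow> nat \<Rightarrow> 'a::heine_borel"
  assumes "finite I" and "\<And>i. i \<in> I \<Longrightarrow> bounded (range (f i))"
  obtains r l where "strict_mono (r :: nat \<Rightarrow> nat)" "\<And>i. i \<in> I \<Longrightarrow> (f i \<circ> r) \<longlonglongrightarrow> l i"
proof -
  have "\<exists>r l. strict_mono (r :: nat \<Rightarrow> nat) \<and> (\<forall>i\<in>I. (f i \<circ> r) \<longlonglongrightarrow> l i)"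
    using assms
  proof (induction I)
    case empty
    show ?case using strict_mono_id by auto
  next
    case (insert j I)
    have "\<exists>r l. strict_mono (r :: nat \<Rightarrow> nat) \<and> (\<forall>i\<in>I. (f i \<circ> r) \<longlonglongrightarrow> l i)"
      by (rule insert.IH) (use insert.prems in auto)
    then obtain r l where r: "strict_mono (r :: nat \<Rightarrow> nat)" "\<forall>i\<in>I. (f i \<circ> r) \<longlonglongrightarrow> l i"
      by blast
    have "bounded (range (f j \<circ> r))"
      by (rule bounded_subset[OF insert.prems[of j]]) auto
    then obtain c q where q: "strict_mono (q :: nat \<Rightarrow> nat)" "(f j \<circ> r \<circ> q) \<longlonglongrightarrow> c"
      using bounded_imp_convergent_subsequence by metis
    have "(f i \<circ> (r \<circ> q)) \<longlonglongrightarrow> (l(j := c)) i" if "i \<in> insert j I" for i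
    proof (cases "i = j")
      case True
      then show ?thesis using q by (simp add: o_assoc)
    next
      case False
      then show ?thesis
        using that r(2) LIMSEQ_subseq_LIMSEQ[OF _ q(1), of "f i \<circ> r" "l i"] by (auto simp: o_assoc)
    qed
    moreover have "strict_mono (r \<circ> q)" using r q by (simp add: strict_mono_o)
    ultimately show ?case by blast
  qed
  then show ?thesis using that by auto
qed

text \<open>
  The method for general closed sets and continuous functions, in terms of the optimality
  conditions of its updates. \<open>Domain E\<close> and \<open>Range E\<close> are the two colour classes. The drift term
  in \<open>primal_step\<close> is an empty sum at the nodes of \<open>Range E\<close>: these are updated second and see
  the new values of their neighbours.
\<close>

locale bipartite_consensus_admm =
  fixes V :: "'v set" and E :: "('v \<times> 'v) set"
    and F :: "'v \<Rightarrow> 'a::euclidean_space \<Rightarrow> real" and S :: "'v \<Rightarrow> 'a set" and \<rho> :: real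
    and x :: "'v \<Rightarrow> nat \<Rightarrow> 'a" and L :: "'v \<times> 'v \<Rightarrow> nat \<Rightarrow> 'a"
  assumes finite_V: "finite V" and E_subset: "E \<subseteq> V \<times> V"
    and bipartite: "Domain E \<inter> Range E = {}" and E_nonempty: "E \<noteq> {}"
    and connected: "\<And>u v. u \<in> V \<Longrightarrow> v \<in> V \<Longrightarrow> (u, v) \<in> (E \<union> E\<inverse>)\<^sup>*"
    and rho_pos: "\<rho> > 0"
    and closed_S: "\<And>v. v \<in> V \<Longrightarrow> closed (S v)"
    and cont_F: "\<And>v. v \<in> V \<Longrightarrow> continuous_on UNIV (F v)"
    and dual_step: "\<And>e k. e \<in> E \<Longrightarrow>
      L e (Suc k) = L e k + \<rho> *\<^sub>R (x (fst e) (Suc k) - x (snd e) (Suc k))"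
    and primal_step: "\<And>v k. v \<in> V \<Longrightarrow>
      tilted_minimizer (F v) (S v)
        (net_flow E (\<lambda>e. L e (Suc k)) v
          + \<rho> *\<^sub>R (\<Sum>e | e \<in> E \<and> fst e = v. x (snd e) (Suc k) - x (snd e) k))
        (x v (Suc k))"
begin

text \<open>
  The copies, all equal to \<open>z\<close>, minimize the Lagrangian in which \<open>M (p, q)\<close> is the multiplier
  of the constraint \<open>x\<^sub>p = x\<^sub>q\<close>.
\<close>

definition saddle :: "'a \<Rightarrow> ('v \<times> 'v \<Rightarrow> 'a) \<Rightarrow> bool" where
  "saddle z M \<longleftrightarrow> (\<forall>v\<in>V. tilted_minimizer (F v) (S v) (net_flow E M v) z)"

definition energy :: "'a \<Rightarrow> ('v \<times> 'v \<Rightarrow> 'a) \<Rightarrow> nat \<Rightarrow> real" where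
  "energy z M k =
     (\<Sum>e\<in>E. (norm (L e k - M e))\<^sup>2 / \<rho> + \<rho> * (norm (x (snd e) k - z))\<^sup>2)"

definition gap :: "'v \<times> 'v \<Rightarrow> nat \<Rightarrow> 'a" where
  "gap e k = x (fst e) k - x (snd e) k"

definition drift :: "'v \<times> 'v \<Rightarrow> nat \<Rightarrow> 'a" where
  "drift e k = x (snd e) (Suc k) - x (snd e) k"

lemma finite_E: "finite E"
  using finite_V E_subset by (meson finite_SigmaI finite_subset)

lemma energy_nonneg: "0 \<le> energy z M k"
  unfolding energy_def using rho_pos by (intro sum_nonneg) auto

text \<open>
  The contribution of one edge to the energy balance: \<open>a\<close> and \<open>w\<close> are the old errors of
  multiplier and sink value, \<open>r\<close> and \<open>d\<close> the new gap and the drift. The last bracket, where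
  \<open>r + w + d\<close> is the new error of the source value, is what the optimality conditions control.
\<close>

lemma edge_energy_identity:
  fixes a r w d :: 'a
  shows "(norm (a + \<rho> *\<^sub>R r))\<^sup>2 / \<rho> + \<rho> * (norm (w + d))\<^sup>2
      + \<rho> * ((norm r)\<^sup>2 + (norm d)\<^sup>2 + 2 * (d \<bullet> r))
    = (norm a)\<^sup>2 / \<rho> + \<rho> * (norm w)\<^sup>2 + 2 * ((a + \<rho> *\<^sub>R r) \<bullet> r + \<rho> * (d \<bullet> (r + w + d)))"
  using rho_pos
  by (simp add: power2_norm_eq_inner inner_add_left inner_add_right inner_commute field_simps)

text \<open>
  Monotonicity between the new iterates and the saddle point, summed over the nodes and rewritten
  over the edges, bounds the last bracket of \<open>edge_energy_identity\<close> by 0.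
\<close>

lemma energy_step:
  assumes "saddle z M"
  shows "energy z M (Suc k)
      + \<rho> * (\<Sum>e\<in>E. (norm (gap e (Suc k)))\<^sup>2 + (norm (drift e k))\<^sup>2
                     + 2 * (drift e k \<bullet> gap e (Suc k)))
    \<le> energy z M k"
proof -
  let ?N = "\<lambda>e. L e (Suc k) - M e"
  have mono: "(net_flow E ?N v + \<rho> *\<^sub>R (\<Sum>e | e \<in> E \<and> fst e = v. drift e k))
      \<bullet> (x v (Suc k) - z) \<le> 0" if "v \<in> V" for v
  proof -
    have "(net_flow E (\<lambda>e. L e (Suc k)) v + \<rho> *\<^sub>R (\<Sum>e | e \<in> E \<and> fst e = v. drift e k)
        - net_flow E M v) \<bullet> (x v (Suc k) - z) \<le> 0"
      using tilted_minimizer_monotone[OF primal_step[OF that]] assms that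
      unfolding saddle_def drift_def by blast
    then show ?thesis by (simp add: net_flow_diff algebra_simps)
  qed
  have "(\<Sum>e\<in>E. ?N e \<bullet> gap e (Suc k) + \<rho> * (drift e k \<bullet> (x (fst e) (Suc k) - z)))
    = (\<Sum>v\<in>V. net_flow E ?N v \<bullet> (x v (Suc k) - z))
      + \<rho> * (\<Sum>v\<in>V. (\<Sum>e | e \<in> E \<and> fst e = v. drift e k) \<bullet> (x v (Suc k) - z))"
    unfolding sum_net_flow_inner[OF finite_V E_subset] sum_incident_inner[OF finite_V E_subset]
    by (simp add: sum.distrib sum_distrib_left gap_def)
  also have "\<dots> = (\<Sum>v\<in>V. (net_flow E ?N v + \<rho> *\<^sub>R (\<Sum>e | e \<in> E \<and> fst e = v. drift e k))
      \<bullet> (x v (Suc k) - z))"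
    by (simp add: sum.distrib sum_distrib_left inner_add_left)
  also have "\<dots> \<le> 0" using mono by (rule sum_nonpos)
  finally have le: "(\<Sum>e\<in>E. ?N e \<bullet> gap e (Suc k) + \<rho> * (drift e k \<bullet> (x (fst e) (Suc k) - z))) \<le> 0" .
  have edge: "(norm (?N e))\<^sup>2 / \<rho> + \<rho> * (norm (x (snd e) (Suc k) - z))\<^sup>2
      + \<rho> * ((norm (gap e (Suc k)))\<^sup>2 + (norm (drift e k))\<^sup>2 + 2 * (drift e k \<bullet> gap e (Suc k)))
    = ((norm (L e k - M e))\<^sup>2 / \<rho> + \<rho> * (norm (x (snd e) k - z))\<^sup>2)
      + 2 * (?N e \<bullet> gap e (Suc k) + \<rho> * (drift e k \<bullet> (x (fst e) (Suc k) - z)))"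
    if "e \<in> E" for e
  proof -
    have N: "?N e = (L e k - M e) + \<rho> *\<^sub>R gap e (Suc k)"
      using dual_step[OF that] by (simp add: gap_def)
    have X: "x (snd e) (Suc k) - z = (x (snd e) k - z) + drift e k"
      by (simp add: drift_def)
    have Y: "x (fst e) (Suc k) - z = gap e (Suc k) + (x (snd e) k - z) + drift e k"
      by (simp add: drift_def gap_def)
    show ?thesis unfolding N X Y by (rule edge_energy_identity)
  qed
  have "energy z M (Suc k)
      + \<rho> * (\<Sum>e\<in>E. (norm (gap e (Suc k)))\<^sup>2 + (norm (drift e k))\<^sup>2
                     + 2 * (drift e k \<bullet> gap e (Suc k)))
    = energy z M k
      + 2 * (\<Sum>e\<in>E. ?N e \<bullet> gap e (Suc k) + \<rho> * (drift e k \<bullet> (x (fst e) (Suc k) - z)))"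
    unfolding energy_def sum_distrib_left sum.distrib[symmetric]
    using edge by (intro sum.cong refl) (simp add: algebra_simps)
  then show ?thesis using le by simp
qed

text \<open>
  The cross term of \<open>energy_step\<close> has a favourable sign because the slopes at the sinks contain no
  drift: monotonicity between two consecutive iterates at the sinks is this inequality. It needs
  both iterates to be minimizers, so it holds from the second step on.
\<close>

lemma drift_gap_nonneg: "0 \<le> (\<Sum>e\<in>E. drift e (Suc k) \<bullet> gap e (Suc (Suc k)))"
proof -
  \<comment> \<open>Setting the potential to 0 at the sources confines the summation by parts to the sinks.\<close>
  let ?y = "\<lambda>v. if v \<in> Range E then x v (Suc (Suc k)) - x v (Suc k) else 0"
  let ?N = "\<lambda>e. L e (Suc (Suc k)) - L e (Suc k)"
  have sink: "tilted_minimizer (F v) (S v) (net_flow E (\<lambda>e. L e (Suc j)) v) (x v (Suc j))"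
    if "v \<in> V" "v \<in> Range E" for v j
  proof -
    have no_out: "{e. e \<in> E \<and> fst e = v} = {}"
      using that bipartite by fastforce
    show ?thesis using primal_step[OF that(1), of j] unfolding no_out by simp
  qed
  have "net_flow E ?N v \<bullet> ?y v \<le> 0" if "v \<in> V" for v
    using tilted_minimizer_monotone[OF sink sink] that by (auto simp: net_flow_diff)
  then have "(\<Sum>v\<in>V. net_flow E ?N v \<bullet> ?y v) \<le> 0" by (rule sum_nonpos)
  then have "(\<Sum>e\<in>E. ?N e \<bullet> (?y (fst e) - ?y (snd e))) \<le> 0"
    unfolding sum_net_flow_inner[OF finite_V E_subset] .
  also have "(\<Sum>e\<in>E. ?N e \<bullet> (?y (fst e) - ?y (snd e)))
      = (\<Sum>e\<in>E. - \<rho> * (drift e (Suc k) \<bullet> gap e (Suc (Suc k))))"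
  proof (intro sum.cong refl)
    fix e assume e: "e \<in> E"
    have "fst e \<notin> Range E" "snd e \<in> Range E"
      using e bipartite by (cases e; fastforce)+
    then have Y: "?y (fst e) - ?y (snd e) = - drift e (Suc k)"
      by (simp add: drift_def)
    have N: "?N e = \<rho> *\<^sub>R gap e (Suc (Suc k))"
      using dual_step[OF e, of "Suc k"] by (simp add: gap_def)
    show "?N e \<bullet> (?y (fst e) - ?y (snd e)) = - \<rho> * (drift e (Suc k) \<bullet> gap e (Suc (Suc k)))"
      unfolding N Y by (simp add: inner_commute)
  qed
  also have "\<dots> = - \<rho> * (\<Sum>e\<in>E. drift e (Suc k) \<bullet> gap e (Suc (Suc k)))"
    by (simp add: sum_distrib_left)
  finally show ?thesis using rho_pos by (simp add: zero_le_mult_iff)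
qed

lemma energy_descent:
  assumes "saddle z M"
  shows "energy z M (Suc (Suc k))
      + \<rho> * (\<Sum>e\<in>E. (norm (gap e (Suc (Suc k))))\<^sup>2 + (norm (drift e (Suc k)))\<^sup>2)
    \<le> energy z M (Suc k)"
proof -
  have "\<rho> * (\<Sum>e\<in>E. (norm (gap e (Suc (Suc k))))\<^sup>2 + (norm (drift e (Suc k)))\<^sup>2)
    \<le> \<rho> * (\<Sum>e\<in>E. (norm (gap e (Suc (Suc k))))\<^sup>2 + (norm (drift e (Suc k)))\<^sup>2
                     + 2 * (drift e (Suc k) \<bullet> gap e (Suc (Suc k))))"
    using drift_gap_nonneg[of k] rho_pos
    by (intro mult_left_mono) (simp_all add: sum.distrib sum_distrib_left[symmetric])
  then show ?thesis using energy_step[OF assms, of "Suc k"] by linarith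
qed

lemma decseq_energy:
  assumes "saddle z M"
  shows "decseq (\<lambda>k. energy z M (Suc k))"
proof (rule decseq_SucI)
  fix k
  have "0 \<le> \<rho> * (\<Sum>e\<in>E. (norm (gap e (Suc (Suc k))))\<^sup>2 + (norm (drift e (Suc k)))\<^sup>2)"
    using rho_pos by (intro mult_nonneg_nonneg sum_nonneg) auto
  then show "energy z M (Suc (Suc k)) \<le> energy z M (Suc k)"
    using energy_descent[OF assms, of k] by linarith
qed

text \<open>
  The decrements of a convergent sequence tend to 0, and they dominate the squared gaps and drifts.
\<close>

lemma gap_drift_tendsto_zero:
  assumes "saddle z M" and "e \<in> E"
  shows "gap e \<longlonglongrightarrow> 0" and "drift e \<longlonglongrightarrow> 0"
proof -
  let ?W = "\<lambda>k. energy z M (Suc k)"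
  obtain l where l: "?W \<longlonglongrightarrow> l"
    using decseq_convergent[OF decseq_energy[OF assms(1)], of 0] energy_nonneg by metis
  have "(\<lambda>k. (?W k - ?W (Suc k)) / \<rho>) \<longlonglongrightarrow> (l - l) / \<rho>"
    using rho_pos by (intro tendsto_intros l LIMSEQ_Suc) auto
  then have lim: "(\<lambda>k. (?W k - ?W (Suc k)) / \<rho>) \<longlonglongrightarrow> 0" by simp
  have bound: "(norm (gap e (Suc (Suc k))))\<^sup>2 + (norm (drift e (Suc k)))\<^sup>2 \<le> (?W k - ?W (Suc k)) / \<rho>"
    for k
  proof -
    have "(norm (gap e (Suc (Suc k))))\<^sup>2 + (norm (drift e (Suc k)))\<^sup>2
      \<le> (\<Sum>e\<in>E. (norm (gap e (Suc (Suc k))))\<^sup>2 + (norm (drift e (Suc k)))\<^sup>2)"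
      using finite_E assms(2)
      by (intro member_le_sum[of e E "\<lambda>e. (norm (gap e (Suc (Suc k))))\<^sup>2 + (norm (drift e (Suc k)))\<^sup>2"]) auto
    also have "\<dots> \<le> (?W k - ?W (Suc k)) / \<rho>"
      using energy_descent[OF assms(1), of k] rho_pos by (simp add: field_simps)
    finally show ?thesis .
  qed
  have zero: "h \<longlonglongrightarrow> 0" if "\<And>k. (norm (h k))\<^sup>2 \<le> (?W k - ?W (Suc k)) / \<rho>" for h :: "nat \<Rightarrow> 'a"
  proof -
    have "(\<lambda>k. (norm (h k))\<^sup>2) \<longlonglongrightarrow> 0"
      by (rule tendsto_sandwich[OF _ _ tendsto_const lim]) (use that in auto)
    then have "(\<lambda>k. sqrt ((norm (h k))\<^sup>2)) \<longlonglongrightarrow> sqrt 0" by (rule tendsto_real_sqrt)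
    then show ?thesis by (simp add: tendsto_norm_zero_iff)
  qed
  have "(\<lambda>k. gap e (Suc (Suc k))) \<longlonglongrightarrow> 0"
    using bound by (intro zero) (smt (verit) zero_le_power2)
  then show "gap e \<longlonglongrightarrow> 0" by (rule LIMSEQ_imp_Suc[OF LIMSEQ_imp_Suc])
  have "(\<lambda>k. drift e (Suc k)) \<longlonglongrightarrow> 0"
    using bound by (intro zero) (smt (verit) zero_le_power2)
  then show "drift e \<longlonglongrightarrow> 0" by (rule LIMSEQ_imp_Suc)
qed

lemma consensus:
  assumes "saddle z M" and "u \<in> V" "v \<in> V"
  shows "(\<lambda>k. x u k - x v k) \<longlonglongrightarrow> 0"
  using connected[OF assms(2,3)]
proof (induction rule: rtrancl_induct)
  case base
  show ?case by simp
next
  case (step v w)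
  have "(\<lambda>k. x v k - x w k) \<longlonglongrightarrow> 0"
  proof (cases "(v, w) \<in> E")
    case True
    then show ?thesis using gap_drift_tendsto_zero(1)[OF assms(1) True] by (simp add: gap_def[abs_def])
  next
    case False
    then have "(w, v) \<in> E" using step by auto
    from tendsto_minus[OF gap_drift_tendsto_zero(1)[OF assms(1) this]]
    show ?thesis by (simp add: gap_def[abs_def])
  qed
  from tendsto_add[OF step.IH this] show ?case by simp
qed

lemma edge_le_energy:
  assumes "e \<in> E"
  shows "(norm (L e k - M e))\<^sup>2 \<le> \<rho> * energy z M k"
    and "(norm (x (snd e) k - z))\<^sup>2 \<le> energy z M k / \<rho>"
proof -
  have "(norm (L e k - M e))\<^sup>2 / \<rho> + \<rho> * (norm (x (snd e) k - z))\<^sup>2 \<le> energy z M k"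
    unfolding energy_def using rho_pos finite_E assms
    by (intro member_le_sum[of e E "\<lambda>e. (norm (L e k - M e))\<^sup>2 / \<rho> + \<rho> * (norm (x (snd e) k - z))\<^sup>2"]) auto
  moreover have "0 \<le> (norm (L e k - M e))\<^sup>2 / \<rho>" "0 \<le> \<rho> * (norm (x (snd e) k - z))\<^sup>2"
    using rho_pos by auto
  ultimately have "(norm (L e k - M e))\<^sup>2 / \<rho> \<le> energy z M k"
    "\<rho> * (norm (x (snd e) k - z))\<^sup>2 \<le> energy z M k" by linarith+
  then show "(norm (L e k - M e))\<^sup>2 \<le> \<rho> * energy z M k"
    "(norm (x (snd e) k - z))\<^sup>2 \<le> energy z M k / \<rho>"
    using rho_pos by (simp_all add: field_simps)
qed

lemma bounded_iterates:
  assumes "saddle z M" and "e \<in> E"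
  shows "bounded (range (\<lambda>k. L e (Suc k)))" and "bounded (range (\<lambda>k. x (snd e) (Suc k)))"
proof -
  have W: "energy z M (Suc k) \<le> energy z M (Suc 0)" for k
    using decseqD[OF decseq_energy[OF assms(1)], of 0 k] by simp
  have bdd: "bounded (range h)" if "\<And>k. (norm (h k - c))\<^sup>2 \<le> B" for h :: "nat \<Rightarrow> 'a" and c B
  proof -
    have "norm (h k - c) \<le> sqrt B" for k using that real_le_rsqrt by blast
    then have "range h \<subseteq> cball c (sqrt B)" by (auto simp: dist_norm norm_minus_commute)
    then show ?thesis using bounded_cball bounded_subset by blast
  qed
  show "bounded (range (\<lambda>k. L e (Suc k)))"
    by (rule bdd[of _ "M e" "\<rho> * energy z M (Suc 0)"],
        rule order_trans[OF edge_le_energy(1)[OF assms(2)] mult_left_mono[OF W]])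
       (use rho_pos in auto)
  show "bounded (range (\<lambda>k. x (snd e) (Suc k)))"
    by (rule bdd[of _ z "energy z M (Suc 0) / \<rho>"],
        rule order_trans[OF edge_le_energy(2)[OF assms(2)] divide_right_mono[OF W]])
       (use rho_pos in auto)
qed

text \<open>
  One sink value and the multipliers converge along a common subsequence. The other nodes follow
  by consensus, and the optimality conditions are closed under limits, with the drift vanishing.
\<close>

lemma saddle_cluster_point:
  assumes "saddle z M"
  obtains r z' M' where "strict_mono r" and "saddle z' M'"
    and "\<And>v. v \<in> V \<Longrightarrow> (\<lambda>k. x v (Suc (r k))) \<longlonglongrightarrow> z'"
    and "\<And>e. e \<in> E \<Longrightarrow> (\<lambda>k. L e (Suc (r k))) \<longlonglongrightarrow> M' e"
proof -
  obtain e\<^sub>0 where e0: "e\<^sub>0 \<in> E" using E_nonempty by blast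
  \<comment> \<open>\<open>None\<close> indexes the sink value, \<open>Some e\<close> the multiplier of \<open>e\<close>.\<close>
  let ?f = "\<lambda>i k. case i of None \<Rightarrow> x (snd e\<^sub>0) (Suc k) | Some e \<Rightarrow> L e (Suc k)"
  have bdd: "bounded (range (?f i))" if "i \<in> insert None (Some ` E)" for i
    using that bounded_iterates(1)[OF assms] bounded_iterates(2)[OF assms e0]
    by (auto simp del: split_paired_All)
  obtain r l where r: "strict_mono r"
    and l: "\<And>i. i \<in> insert None (Some ` E) \<Longrightarrow> (?f i \<circ> r) \<longlonglongrightarrow> l i"
    using common_convergent_subsequence[of "insert None (Some ` E)" ?f] bdd finite_E by auto
  have L: "(\<lambda>k. L e (Suc (r k))) \<longlonglongrightarrow> l (Some e)" if "e \<in> E" for e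
    using l[of "Some e"] that by (simp add: o_def)
  have "snd e\<^sub>0 \<in> V" using e0 E_subset by auto
  have x: "(\<lambda>k. x v (Suc (r k))) \<longlonglongrightarrow> l None" if "v \<in> V" for v
  proof -
    have "(\<lambda>k. x v (Suc k) - x (snd e\<^sub>0) (Suc k)) \<longlonglongrightarrow> 0"
      using LIMSEQ_Suc[OF consensus[OF assms that \<open>snd e\<^sub>0 \<in> V\<close>]] .
    from tendsto_add[OF LIMSEQ_subseq_LIMSEQ[OF this r] l[of None]]
    show ?thesis by (simp add: o_def)
  qed
  have "tilted_minimizer (F v) (S v) (net_flow E (\<lambda>e. l (Some e)) v) (l None)" if "v \<in> V" for v
  proof (rule tilted_minimizer_limit[OF primal_step[OF that] closed_S[OF that] cont_F[OF that] _ x[OF that]])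
    have d: "(\<lambda>k. drift e (r k)) \<longlonglongrightarrow> 0" if "e \<in> E" for e
      using LIMSEQ_subseq_LIMSEQ[OF gap_drift_tendsto_zero(2)[OF assms that] r] by (simp add: o_def)
    have "(\<lambda>k. net_flow E (\<lambda>e. L e (Suc (r k))) v
          + \<rho> *\<^sub>R (\<Sum>e | e \<in> E \<and> fst e = v. drift e (r k)))
        \<longlonglongrightarrow> net_flow E (\<lambda>e. l (Some e)) v + \<rho> *\<^sub>R (\<Sum>e | e \<in> E \<and> fst e = v. 0)"
      by (intro tendsto_intros net_flow_tendsto L) (auto intro: d)
    then show "(\<lambda>k. net_flow E (\<lambda>e. L e (Suc (r k))) v
          + \<rho> *\<^sub>R (\<Sum>e | e \<in> E \<and> fst e = v. x (snd e) (Suc (r k)) - x (snd e) (r k)))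
        \<longlonglongrightarrow> net_flow E (\<lambda>e. l (Some e)) v"
      by (simp add: drift_def)
  qed
  then have "saddle (l None) (\<lambda>e. l (Some e))" by (simp add: saddle_def)
  from that[OF r this x L] show thesis .
qed

text \<open>
  The energy may be measured from any saddle point, in particular from a cluster point of the
  iteration itself. Its energy then tends to 0 along a subsequence, hence altogether.
\<close>

theorem converges_to_saddle:
  assumes "saddle z\<^sub>0 M\<^sub>0"
  obtains z M where "saddle z M" and "\<And>v. v \<in> V \<Longrightarrow> x v \<longlonglongrightarrow> z"
proof -
  obtain r z M where r: "strict_mono r" and zM: "saddle z M"
    and x: "\<And>v. v \<in> V \<Longrightarrow> (\<lambda>k. x v (Suc (r k))) \<longlonglongrightarrow> z"
    and L: "\<And>e. e \<in> E \<Longrightarrow> (\<lambda>k. L e (Suc (r k))) \<longlonglongrightarrow> M e"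
    using saddle_cluster_point[OF assms] by metis
  let ?W = "\<lambda>k. energy z M (Suc k)"
  obtain l where l: "?W \<longlonglongrightarrow> l"
    using decseq_convergent[OF decseq_energy[OF zM], of 0] energy_nonneg by metis
  have "(\<lambda>k. ?W (r k)) \<longlonglongrightarrow> (\<Sum>e\<in>E. (norm (M e - M e))\<^sup>2 / \<rho> + \<rho> * (norm (z - z))\<^sup>2)"
    unfolding energy_def using rho_pos E_subset
    by (intro tendsto_intros L x) auto
  moreover have "(\<lambda>k. ?W (r k)) \<longlonglongrightarrow> l"
    using LIMSEQ_subseq_LIMSEQ[OF l r] by (simp add: o_def)
  ultimately have "l = 0" using LIMSEQ_unique by fastforce
  obtain e where e: "e \<in> E" using E_nonempty by blast
  then have "snd e \<in> V" using E_subset by auto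
  have "(\<lambda>k. ?W k / \<rho>) \<longlonglongrightarrow> l / \<rho>" using rho_pos by (intro tendsto_intros l) auto
  then have "(\<lambda>k. ?W k / \<rho>) \<longlonglongrightarrow> 0" using \<open>l = 0\<close> by simp
  then have "(\<lambda>k. (norm (x (snd e) (Suc k) - z))\<^sup>2) \<longlonglongrightarrow> 0"
    by (rule tendsto_sandwich[OF _ _ tendsto_const, rotated 2]) (use edge_le_energy(2)[OF e] in auto)
  then have "(\<lambda>k. sqrt ((norm (x (snd e) (Suc k) - z))\<^sup>2)) \<longlonglongrightarrow> sqrt 0" by (rule tendsto_real_sqrt)
  then have "(\<lambda>k. x (snd e) (Suc k) - z) \<longlonglongrightarrow> 0" by (simp add: tendsto_norm_zero_iff)
  then have sink: "(\<lambda>k. x (snd e) k - z) \<longlonglongrightarrow> 0" by (rule LIMSEQ_imp_Suc)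
  have "x v \<longlonglongrightarrow> z" if "v \<in> V" for v
    using tendsto_add[OF consensus[OF zM that \<open>snd e \<in> V\<close>] sink] LIM_zero_cancel by fastforce
  from that[OF zM this] show thesis .
qed

end

section \<open>Balanced demands are net flows\<close>

lemma net_flow_single_edge:
  assumes "finite E" "(u, v) \<in> E"
  shows "net_flow E (\<lambda>e. of_bool (e = (u, v)) :: real) w = of_bool (w = u) - of_bool (w = v)"
proof -
  have "(\<Sum>e\<in>{e \<in> E. f e = w}. of_bool (e = (u, v)) :: real) = of_bool (f (u, v) = w)"
    for f :: "'a \<times> 'a \<Rightarrow> 'a"
  proof -
    have "finite {e \<in> E. f e = w}" using assms(1) by simp
    from sum.delta[OF this, of "(u, v)" "\<lambda>_. 1 :: real"] show ?thesis
      using assms(2) by (auto simp: of_bool_def)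
  qed
  from this[of fst] this[of snd] show ?thesis
    unfolding net_flow_def by (simp add: eq_commute)
qed

text \<open>
  Send one unit along a path from \<open>u\<close> to \<open>v\<close>, with a negative sign on the edges that are
  traversed backwards.
\<close>

lemma transfer_flow_exists:
  assumes "finite E" and "(u, v) \<in> (E \<union> E\<inverse>)\<^sup>*"
  shows "\<exists>m. \<forall>w. net_flow E m w = (of_bool (w = u) - of_bool (w = v) :: real)"
  using assms(2)
proof (induction rule: rtrancl_induct)
  case base
  show ?case by (rule exI[of _ "\<lambda>_. 0"]) (simp add: net_flow_zero)
next
  case (step v w)
  then obtain m where m: "\<And>y. net_flow E m y = (of_bool (y = u) - of_bool (y = v) :: real)" by blast
  from step(2) consider "(v, w) \<in> E" | "(w, v) \<in> E" by blast
  then show ?case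
  proof cases
    case 1
    show ?thesis
      by (rule exI[of _ "\<lambda>e. m e + of_bool (e = (v, w))"])
        (simp only: net_flow_add m net_flow_single_edge[OF assms(1) 1], simp)
  next
    case 2
    show ?thesis
      by (rule exI[of _ "\<lambda>e. m e - of_bool (e = (w, v))"])
        (simp only: net_flow_diff m net_flow_single_edge[OF assms(1) 2], simp)
  qed
qed

text \<open>
  Every node sends its demand to a root \<open>r\<close>; what arrives there is the total demand, which is 0.
\<close>

lemma balanced_flow_exists:
  fixes s :: "'v \<Rightarrow> 'a::real_vector"
  assumes "finite V" "finite E"
    and conn: "\<And>u v. u \<in> V \<Longrightarrow> v \<in> V \<Longrightarrow> (u, v) \<in> (E \<union> E\<inverse>)\<^sup>*"
    and bal: "(\<Sum>v\<in>V. s v) = 0"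
  obtains M where "\<And>v. v \<in> V \<Longrightarrow> net_flow E M v = s v"
proof (cases "V = {}")
  case True
  then show ?thesis using that by blast
next
  case False
  then obtain r where r: "r \<in> V" by blast
  have "\<forall>u\<in>V. \<exists>m. \<forall>w. net_flow E m w = (of_bool (w = u) - of_bool (w = r) :: real)"
    using transfer_flow_exists[OF assms(2)] conn r by blast
  then obtain m where m: "\<And>u w. u \<in> V \<Longrightarrow>
      net_flow E (m u) w = (of_bool (w = u) - of_bool (w = r) :: real)"
    by metis
  have "net_flow E (\<lambda>e. \<Sum>u\<in>V. m u e *\<^sub>R s u) v = s v" if v: "v \<in> V" for v
  proof -
    have "net_flow E (\<lambda>e. \<Sum>u\<in>V. m u e *\<^sub>R s u) v = (\<Sum>u\<in>V. net_flow E (m u) v *\<^sub>R s u)"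
      unfolding net_flow_def scaleR_left_diff_distrib sum_subtractf scaleR_sum_left
      by (subst (1 2) sum.swap) (rule refl)
    also have "\<dots> = (\<Sum>u\<in>V. of_bool (v = u) *\<^sub>R s u - of_bool (v = r) *\<^sub>R s u)"
      by (intro sum.cong refl) (simp only: m scaleR_left_diff_distrib)
    also have "\<dots> = (\<Sum>u\<in>V. of_bool (v = u) *\<^sub>R s u) - of_bool (v = r) *\<^sub>R (\<Sum>u\<in>V. s u)"
      by (simp add: sum_subtractf scaleR_sum_right)
    also have "(\<Sum>u\<in>V. of_bool (v = u) *\<^sub>R s u) = (\<Sum>u\<in>V. if v = u then s u else 0)"
      by (intro sum.cong) auto
    also have "\<dots> = s v" using assms(1) v by simp
    finally show ?thesis using bal by simp
  qed
  then show ?thesis by (rule that)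
qed

section \<open>Convex minimization\<close>

lemma coercive_attains_inf:
  fixes f :: "'a::euclidean_space \<Rightarrow> real"
  assumes "closed S" "z\<^sub>0 \<in> S" "continuous_on UNIV f" and bdd: "bounded {z. f z \<le> f z\<^sub>0}"
  obtains u where "u \<in> S" "\<And>z. z \<in> S \<Longrightarrow> f u \<le> f z"
proof -
  let ?T = "S \<inter> {z. f z \<le> f z\<^sub>0}"
  have "closed {z. f z \<le> f z\<^sub>0}"
    using assms(3) by (intro closed_Collect_le) auto
  then have "compact ?T"
    using assms(1) bdd by (simp add: compact_eq_bounded_closed bounded_Int closed_Int)
  moreover have "z\<^sub>0 \<in> ?T" using assms(2) by simp
  moreover have "continuous_on ?T f" using assms(3) continuous_on_subset by blast
  ultimately obtain u where u: "u \<in> ?T" "\<forall>z\<in>?T. f u \<le> f z"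
    using continuous_attains_inf[of ?T f] by blast
  have "f u \<le> f z\<^sub>0" using u(2) \<open>z\<^sub>0 \<in> ?T\<close> by blast
  then have "f u \<le> f z" if "z \<in> S" for z
    using u(2) that by (cases "f z \<le> f z\<^sub>0") auto
  with u(1) that show thesis by blast
qed

text \<open>
  The pairs of a constraint residual and a number exceeding the corresponding increase of \<open>f\<close>
  form a convex set that misses the origin. The normal of a separating hyperplane, scaled
  to have last component 1, gives the multiplier. Surjectivity of \<open>A\<close> prevents the hyperplane
  from being vertical, which is the case of last component 0.
\<close>

lemma convex_equality_multiplier:
  fixes A :: "real ^ 'n ^ 'm" and f :: "real ^ 'n \<Rightarrow> real"
  assumes conv: "convex_on UNIV f" and surj: "surj ((*v) A)"
    and u: "A *v u = b" and min: "\<And>z. A *v z = b \<Longrightarrow> f u \<le> f z"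
  obtains l where "\<And>z. f u \<le> f z + l \<bullet> (A *v z - b)"
proof -
  let ?C = "{(A *v z - b, r) | z r. f z - f u < r}"
  have "convex ?C"
  proof (rule convexI)
    fix p q :: "(real ^ 'm) \<times> real" and s t :: real
    assume pq: "p \<in> ?C" "q \<in> ?C" and st: "0 \<le> s" "0 \<le> t" "s + t = 1"
    from pq obtain z w where p: "fst p = A *v z - b" "f z - f u < snd p"
      and q: "fst q = A *v w - b" "f w - f u < snd q"
      by auto
    let ?y = "s *\<^sub>R z + t *\<^sub>R w"
    have "f ?y \<le> s * f z + t * f w"
      using conv st unfolding convex_on_def by auto
    moreover have "s * (f z - f u) + t * (f w - f u) < s * snd p + t * snd q"
    proof (cases "s = 0")
      case True
      then show ?thesis using st q by simp
    next
      case False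
      then have "s * (f z - f u) < s * snd p" using st p by simp
      moreover have "t * (f w - f u) \<le> t * snd q" using st q by (intro mult_left_mono) auto
      ultimately show ?thesis by linarith
    qed
    moreover have "s * (f z - f u) + t * (f w - f u) = s * f z + t * f w - (s + t) * f u"
      by (simp add: algebra_simps)
    ultimately have "f ?y - f u < s * snd p + t * snd q" using st by simp
    moreover have "s *\<^sub>R fst p + t *\<^sub>R fst q = A *v ?y - b"
    proof -
      have "s *\<^sub>R fst p + t *\<^sub>R fst q = A *v ?y - (s + t) *\<^sub>R b"
        unfolding p q by (simp add: algebra_simps matrix_vector_mult_scaleR)
      then show ?thesis using st by simp
    qed
    ultimately show "s *\<^sub>R p + t *\<^sub>R q \<in> ?C"
      by (auto simp: prod_eq_iff intro!: exI[of _ ?y])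
  qed
  moreover have "0 \<notin> ?C" using min by (force simp: zero_prod_def)
  ultimately obtain a where a: "a \<noteq> 0" "\<forall>p\<in>?C. 0 \<le> a \<bullet> p"
    using separating_hyperplane_set_0 by blast
  obtain l m where lm: "a = (l, m)" by fastforce
  have ineq: "0 \<le> l \<bullet> (A *v z - b) + m * r" if "f z - f u < r" for z r
    using a(2) that unfolding lm by force
  have "0 \<le> m" using ineq[of u 1] u by simp
  moreover have "m \<noteq> 0"
  proof
    assume "m = 0"
    \<comment> \<open>A vertical hyperplane is refuted by the residual \<open>- l\<close>.\<close>
    obtain z where "A *v z = b - l" using surj by (metis surjD)
    with ineq[of z "f z - f u + 1"] \<open>m = 0\<close> have "l \<bullet> l \<le> 0" by simp
    then have "l = 0" by (metis inner_eq_zero_iff inner_ge_zero order_antisym)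
    with \<open>m = 0\<close> a(1) lm show False by (simp add: zero_prod_def)
  qed
  ultimately have m: "m > 0" by simp
  have "f u \<le> f z + (l /\<^sub>R m) \<bullet> (A *v z - b)" for z
  proof (rule field_le_epsilon)
    fix d :: real assume "0 < d"
    then have "0 \<le> l \<bullet> (A *v z - b) + m * (f z - f u + d)" by (intro ineq) simp
    then have "0 \<le> inverse m * (l \<bullet> (A *v z - b) + m * (f z - f u + d))"
      using m by simp
    also have "\<dots> = (l /\<^sub>R m) \<bullet> (A *v z - b) + (f z - f u + d)"
      using m by (simp add: field_simps)
    finally show "f u \<le> f z + (l /\<^sub>R m) \<bullet> (A *v z - b) + d" by simp
  qed
  then show thesis by (rule that)
qed

text \<open>
  The quadratic term may be replaced by its linearization at the minimizer. On the segment from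
  \<open>u\<close> to \<open>z\<close> the error is of second order in the distance, so it disappears after
  dividing by the step length \<open>t\<close> and letting \<open>t\<close> tend to 0.
\<close>

lemma prox_minimizer_is_tilted_minimizer:
  fixes F :: "'a::real_inner \<Rightarrow> real"
  assumes conv: "convex_on UNIV F" and S: "convex S" and u: "u \<in> S"
    and min: "\<And>z. z \<in> S \<Longrightarrow>
      F u + v \<bullet> u + c / 2 * (norm u)\<^sup>2 \<le> F z + v \<bullet> z + c / 2 * (norm z)\<^sup>2"
  shows "tilted_minimizer F S (v + c *\<^sub>R u) u"
  unfolding tilted_minimizer_def
proof (intro conjI ballI u)
  fix z assume z: "z \<in> S"
  let ?a = "F z - F u + (v + c *\<^sub>R u) \<bullet> (z - u)" and ?B = "c / 2 * (norm (z - u))\<^sup>2"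
  have "0 \<le> ?a + ?B * inverse (real (Suc n))" for n
  proof -
    define t where "t = inverse (real (Suc n))"
    have t: "0 < t" "t \<le> 1" by (auto simp: t_def field_simps)
    define w where "w = (1 - t) *\<^sub>R u + t *\<^sub>R z"
    define p q D where "p = v \<bullet> (z - u)" and "q = u \<bullet> (z - u)" and "D = (norm (z - u))\<^sup>2"
    have "w \<in> S" using S u z t by (simp add: convex_def w_def)
    then have "F u + v \<bullet> u + c / 2 * (norm u)\<^sup>2 \<le> F w + v \<bullet> w + c / 2 * (norm w)\<^sup>2"
      by (rule min)
    moreover have "F w \<le> (1 - t) * F u + t * F z"
      using conv t unfolding convex_on_def w_def by auto
    moreover have "v \<bullet> w = v \<bullet> u + t * p"
      by (simp add: w_def p_def algebra_simps)
    moreover have "(norm w)\<^sup>2 = (norm u)\<^sup>2 + t * (2 * q) + t * t * D"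
      by (simp add: w_def q_def D_def power2_norm_eq_inner algebra_simps inner_commute)
    ultimately have "0 \<le> t * (F z - F u) + t * p + c / 2 * (t * (2 * q) + t * t * D)"
      by (simp add: algebra_simps)
    also have "\<dots> = t * (F z - F u + (p + c * q) + c / 2 * D * t)" by (simp add: algebra_simps)
    also have "p + c * q = (v + c *\<^sub>R u) \<bullet> (z - u)" by (simp add: p_def q_def inner_add_left)
    finally have "0 \<le> t * (?a + ?B * t)" unfolding D_def .
    then show ?thesis using t by (simp add: zero_le_mult_iff t_def)
  qed
  moreover have "(\<lambda>n. ?a + ?B * inverse (real (Suc n))) \<longlonglongrightarrow> ?a + ?B * 0"
    by (intro tendsto_intros LIMSEQ_inverse_real_of_nat)
  ultimately have "0 \<le> ?a + ?B * 0" by (intro LIMSEQ_le_const) auto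
  then show "F u + (v + c *\<^sub>R u) \<bullet> u \<le> F z + (v + c *\<^sub>R u) \<bullet> z"
    by (simp add: algebra_simps)
qed

section \<open>Basis Pursuit and the node problems\<close>

lemma convex_l1_norm: "convex_on UNIV l1_norm"
proof (rule convex_onI)
  fix t :: real and x y :: "real ^ 'n"
  assume t: "0 < t" "t < 1"
  have "\<bar>(1 - t) * x $ i + t * y $ i\<bar> \<le> (1 - t) * \<bar>x $ i\<bar> + t * \<bar>y $ i\<bar>" for i
    using t abs_triangle_ineq[of "(1 - t) * x $ i" "t * y $ i"] by (simp add: abs_mult)
  then have "l1_norm ((1 - t) *\<^sub>R x + t *\<^sub>R y) \<le> (\<Sum>i\<in>UNIV. (1 - t) * \<bar>x $ i\<bar> + t * \<bar>y $ i\<bar>)"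
    unfolding l1_norm_def by (intro sum_mono) simp
  also have "\<dots> = (1 - t) * l1_norm x + t * l1_norm y"
    by (simp add: l1_norm_def sum.distrib sum_distrib_left)
  finally show "l1_norm ((1 - t) *\<^sub>R x + t *\<^sub>R y) \<le> (1 - t) * l1_norm x + t * l1_norm y" .
qed simp

lemma continuous_l1_norm: "continuous_on UNIV l1_norm"
  unfolding l1_norm_def[abs_def] by (intro continuous_intros)

lemma norm_le_l1_norm: "norm x \<le> l1_norm x"
  unfolding l1_norm_def by (rule norm_le_l1_cart)

lemma bp_solution_exists:
  assumes "surj ((*v) (A :: real ^ 'n ^ 'm))"
  obtains z where "bp_solution A b z"
proof -
  obtain z\<^sub>0 where z0: "A *v z\<^sub>0 = b" using assms by (metis surjD)
  have "closed {z. A *v z = b}"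
    by (intro closed_Collect_eq continuous_intros matrix_vector_mult_linear_continuous_on)
  moreover have "bounded {z. l1_norm z \<le> l1_norm z\<^sub>0}"
    using norm_le_l1_norm order_trans by (intro boundedI[of _ "l1_norm z\<^sub>0"]) blast
  ultimately obtain u where "u \<in> {z. A *v z = b}" "\<And>z. z \<in> {z. A *v z = b} \<Longrightarrow> l1_norm u \<le> l1_norm z"
    using coercive_attains_inf[of "{z. A *v z = b}" z\<^sub>0 l1_norm] z0 continuous_l1_norm by auto
  then have "bp_solution A b u" unfolding bp_solution_def is_arg_min_def by fastforce
  then show thesis by (rule that)
qed

lemma closed_block_solutions: "closed (block_solutions A b R p)"
  and convex_block_solutions: "convex (block_solutions A b R p)"
proof -
  have *: "block_solutions A b R p = (\<Inter>i\<in>R p. {z. row i A \<bullet> z = b $ i})"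
    by (auto simp: block_solutions_def)
  show "closed (block_solutions A b R p)" "convex (block_solutions A b R p)"
    unfolding * by (auto intro: closed_hyperplane convex_hyperplane convex_INT)
qed

lemma matrix_vector_mult_row: "(A *v z) $ i = row i A \<bullet> (z :: real ^ 'n)"
  by (simp add: matrix_vector_mul_component row_def)

lemma feasible_iff_blocks:
  assumes "row_partition V R"
  shows "A *v z = b \<longleftrightarrow> (\<forall>p\<in>V. z \<in> block_solutions A b R p)"
  using assms unfolding row_partition_def block_solutions_def vec_eq_iff matrix_vector_mult_row
  by blast

text \<open>
  A node of positive degree has a coercive objective. So the minimum is attained, and the value
  picked by \<open>arg_min_on\<close> is a minimizer.
\<close>

lemma node_update_tilted_minimizer:
  fixes v :: "real ^ 'n"
  assumes "\<rho> > 0" and deg: "card (neighbors G p) > 0"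
    and "block_solutions A b R p \<noteq> {}"
  defines "u \<equiv> node_update G A b R \<rho> p v"
  shows "tilted_minimizer (\<lambda>z. 1 / real (card (pverts G)) * l1_norm z) (block_solutions A b R p)
    (v + (real (card (neighbors G p)) * \<rho>) *\<^sub>R u) u"
proof -
  let ?S = "block_solutions A b R p" and ?f = "local_objective G \<rho> p v"
  let ?c = "real (card (neighbors G p)) * \<rho>"
  have c: "?c > 0" using assms by simp
  obtain z\<^sub>0 where z0: "z\<^sub>0 \<in> ?S" using assms by blast
  have "bounded {z. ?f z \<le> ?f z\<^sub>0}"
  proof (rule boundedI)
    let ?K = "\<bar>?f z\<^sub>0\<bar> + norm v"
    fix z assume "z \<in> {z. ?f z \<le> ?f z\<^sub>0}"
    then have le: "?f z \<le> ?f z\<^sub>0" by simp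
    \<comment> \<open>Where \<open>norm z > 1\<close>, the bound \<open>c / 2 * (norm z)\<^sup>2 \<le> K * norm z\<close> holds.\<close>
    show "norm z \<le> max 1 (?K / (?c / 2))"
    proof (cases "norm z \<le> 1")
      case False
      then have n: "norm z > 1" by simp
      have "0 \<le> 1 / real (card (pverts G)) * l1_norm z"
        using order_trans[OF norm_ge_zero norm_le_l1_norm, of z] by simp
      then have "?c / 2 * (norm z)\<^sup>2 \<le> ?f z\<^sub>0 - v \<bullet> z"
        using le unfolding local_objective_def by linarith
      also have "\<dots> \<le> \<bar>?f z\<^sub>0\<bar> + norm v * norm z"
        using Cauchy_Schwarz_ineq2[of v z] by linarith
      also have "\<dots> \<le> \<bar>?f z\<^sub>0\<bar> * norm z + norm v * norm z"
        using n mult_left_mono[of 1 "norm z" "\<bar>?f z\<^sub>0\<bar>"] by simp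
      finally have "?c / 2 * norm z * norm z \<le> ?K * norm z"
        by (simp add: power2_eq_square algebra_simps)
      then have "?c / 2 * norm z \<le> ?K" by (rule mult_right_le_imp_le) (use n in linarith)
      then have "norm z \<le> ?K / (?c / 2)" using c by (simp only: pos_le_divide_eq half_gt_zero mult.commute)
      then show ?thesis by simp
    qed simp
  qed
  moreover have "continuous_on UNIV ?f"
    unfolding local_objective_def[abs_def] by (intro continuous_intros continuous_l1_norm)
  ultimately obtain w where "w \<in> ?S" "\<And>z. z \<in> ?S \<Longrightarrow> ?f w \<le> ?f z"
    using coercive_attains_inf[OF closed_block_solutions z0] by blast
  then have "is_arg_min ?f (\<lambda>z. z \<in> ?S) w" unfolding is_arg_min_def by fastforce
  then have "is_arg_min ?f (\<lambda>z. z \<in> ?S) u"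
    unfolding u_def node_update_def arg_min_on_def arg_min_def by (rule someI)
  then have u: "u \<in> ?S" "\<And>z. z \<in> ?S \<Longrightarrow> ?f u \<le> ?f z"
    unfolding is_arg_min_def by fastforce+
  show ?thesis
  proof (rule prox_minimizer_is_tilted_minimizer)
    show "convex_on UNIV (\<lambda>z. 1 / real (card (pverts G)) * l1_norm z)"
      by (intro convex_on_cmul convex_l1_norm) simp
  qed (use u convex_block_solutions in \<open>auto simp: local_objective_def\<close>)
qed

lemma vector_matrix_mult_rows: "l v* A = (\<Sum>i\<in>UNIV. (l $ i) *\<^sub>R row i (A :: real ^ 'n ^ 'm))"
  by (simp add: vec_eq_iff vector_matrix_mult_def row_def mult.commute)

text \<open>
  If \<open>l\<close> is a multiplier for \<open>A z = b\<close>, then node \<open>p\<close> gets the slope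
  \<open>A\<^sup>T l / P - A\<^sub>p\<^sup>T l\<^sub>p\<close>. The first part makes \<open>z\<close> optimal for the share \<open>\<parallel>_\<parallel>\<^sub>1 / P\<close>, the second
  part has the same inner product with all points of the block of \<open>p\<close> and makes the slopes sum to 0.
\<close>

lemma bp_multipliers_exist:
  fixes A :: "real ^ 'n ^ 'm"
  assumes V: "finite V" "V \<noteq> {}" and R: "row_partition V R"
    and surj: "surj ((*v) A)" and z: "bp_solution A b z"
  obtains s where "(\<Sum>p\<in>V. s p) = 0"
    and "\<And>p. p \<in> V \<Longrightarrow>
      tilted_minimizer (\<lambda>z. 1 / real (card V) * l1_norm z) (block_solutions A b R p) (s p) z"
proof -
  have Az: "A *v z = b" using z unfolding bp_solution_def is_arg_min_def by blast
  have opt: "l1_norm z \<le> l1_norm w" if "A *v w = b" for w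
    using z that unfolding bp_solution_def is_arg_min_def by force
  obtain l where l: "\<And>w. l1_norm z \<le> l1_norm w + l \<bullet> (A *v w - b)"
    using convex_equality_multiplier[OF convex_l1_norm surj Az opt] by blast
  have card: "real (card V) > 0" using V by (simp add: card_gt_0_iff)
  define s where "s p = (1 / real (card V)) *\<^sub>R (l v* A) - (\<Sum>i\<in>R p. (l $ i) *\<^sub>R row i A)" for p
  show thesis
  proof (rule that)
    have "(\<Sum>p\<in>V. \<Sum>i\<in>R p. (l $ i) *\<^sub>R row i A) = (\<Sum>i\<in>(\<Union>p\<in>V. R p). (l $ i) *\<^sub>R row i A)"
      using R V(1) unfolding row_partition_def disjoint_family_on_def
      by (intro sum.UNION_disjoint[symmetric]) auto
    also have "\<dots> = l v* A"
      using R unfolding row_partition_def vector_matrix_mult_rows by simp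
    finally show "(\<Sum>p\<in>V. s p) = 0"
      using card by (simp add: s_def sum_subtractf sum_constant_scaleR del: sum_constant)
  next
    fix p assume p: "p \<in> V"
    show "tilted_minimizer (\<lambda>z. 1 / real (card V) * l1_norm z) (block_solutions A b R p) (s p) z"
      unfolding tilted_minimizer_def
    proof (intro conjI ballI)
      show zp: "z \<in> block_solutions A b R p" using feasible_iff_blocks[OF R] Az p by blast
      fix w assume w: "w \<in> block_solutions A b R p"
      have "(\<Sum>i\<in>R p. (l $ i) *\<^sub>R row i A) \<bullet> w = (\<Sum>i\<in>R p. (l $ i) *\<^sub>R row i A) \<bullet> z"
        using zp w unfolding inner_sum_left block_solutions_def by (intro sum.cong) auto
      then have "s p \<bullet> w - s p \<bullet> z = 1 / real (card V) * (l \<bullet> (A *v w - b))"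
        by (simp add: s_def inner_diff_left inner_diff_right dot_lmul_matrix Az diff_divide_distrib)
      moreover have "1 / real (card V) * l1_norm z
          \<le> 1 / real (card V) * (l1_norm w + l \<bullet> (A *v w - b))"
        using l card by (intro mult_left_mono) auto
      ultimately show "1 / real (card V) * l1_norm z + s p \<bullet> z \<le> 1 / real (card V) * l1_norm w + s p \<bullet> w"
        by (simp add: distrib_left)
    qed
  qed
qed

text \<open>
  A feasible point of Basis Pursuit competes at all nodes at once, and the linear terms cancel in
  the sum.
\<close>

lemma balanced_minimizer_is_bp_solution:
  fixes A :: "real ^ 'n ^ 'm"
  assumes V: "finite V" "V \<noteq> {}" and R: "row_partition V R"
    and bal: "(\<Sum>p\<in>V. s p) = 0"
    and min: "\<And>p. p \<in> V \<Longrightarrow>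
      tilted_minimizer (\<lambda>z. 1 / real (card V) * l1_norm z) (block_solutions A b R p) (s p) z"
  shows "bp_solution A b z"
proof -
  have card: "real (card V) > 0" using V by (simp add: card_gt_0_iff)
  have "A *v z = b"
    using min unfolding feasible_iff_blocks[OF R] tilted_minimizer_def by blast
  moreover have "l1_norm z \<le> l1_norm w" if "A *v w = b" for w
  proof -
    have "(\<Sum>p\<in>V. 1 / real (card V) * l1_norm z + s p \<bullet> z)
        \<le> (\<Sum>p\<in>V. 1 / real (card V) * l1_norm w + s p \<bullet> w)"
      using min that unfolding feasible_iff_blocks[OF R] tilted_minimizer_def
      by (intro sum_mono) blast
    then show ?thesis
      using card bal by (simp add: sum.distrib inner_sum_left[symmetric])
  qed
  ultimately show ?thesis unfolding bp_solution_def is_arg_min_def by (metis not_less)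
qed

section \<open>D-ADMM on a bipartite graph\<close>

definition oriented_edges :: "'v pair_pre_digraph \<Rightarrow> 'v set \<Rightarrow> 'v set \<Rightarrow> ('v \<times> 'v) set" where
  "oriented_edges G C1 C2 = parcs G \<inter> C1 \<times> C2"

lemma parcs_symmetric:
  assumes "pair_graph G"
  shows "(u, v) \<in> parcs G \<longleftrightarrow> (v, u) \<in> parcs G"
proof -
  interpret pair_graph G by fact
  have "sym (parcs G)" using pair_sym_arcs by (simp add: symmetric_def)
  then show ?thesis by (meson symE)
qed

lemma arc_between_classes:
  assumes "pair_graph G" "proper_2_coloring G C1 C2" "(u, v) \<in> parcs G"
  shows "u \<in> C1 \<and> v \<in> C2 \<or> u \<in> C2 \<and> v \<in> C1"
proof -
  interpret pair_graph G by fact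
  show ?thesis
    using assms(2,3) in_arcsD1[OF assms(3)] in_arcsD2[OF assms(3)]
    unfolding proper_2_coloring_def by blast
qed

lemma edges_at_source:
  assumes "pair_graph G" "proper_2_coloring G C1 C2" "v \<in> C1"
  shows "{e \<in> oriented_edges G C1 C2. fst e = v} = Pair v ` neighbors G v"
    and "{e \<in> oriented_edges G C1 C2. snd e = v} = {}"
  using assms(2,3) arc_between_classes[OF assms(1,2)]
  unfolding oriented_edges_def neighbors_def proper_2_coloring_def by auto

lemma edges_at_sink:
  assumes "pair_graph G" "proper_2_coloring G C1 C2" "v \<in> C2"
  shows "{e \<in> oriented_edges G C1 C2. fst e = v} = {}"
    and "{e \<in> oriented_edges G C1 C2. snd e = v} = (\<lambda>j. (j, v)) ` neighbors G v"
proof -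
  show "{e \<in> oriented_edges G C1 C2. fst e = v} = {}"
    using assms(2,3) unfolding oriented_edges_def proper_2_coloring_def by auto
  have "(j, v) \<in> parcs G \<Longrightarrow> j \<in> C1" for j
    using assms(2,3) arc_between_classes[OF assms(1,2), of j v]
    unfolding proper_2_coloring_def by blast
  then show "{e \<in> oriented_edges G C1 C2. snd e = v} = (\<lambda>j. (j, v)) ` neighbors G v"
    using assms(3) parcs_symmetric[OF assms(1), of v] unfolding oriented_edges_def neighbors_def by auto
qed

text \<open>
  The graph Laplacian: its value at a node depends only on the neighbours, not on the orientation
  of the edges. This is what lets \<open>\<gamma>\<close> be updated without knowing edge multipliers.
\<close>

lemma net_flow_gradient:
  assumes G: "pair_graph G" "proper_2_coloring G C1 C2" and v: "v \<in> pverts G"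
  shows "net_flow (oriented_edges G C1 C2) (\<lambda>e. h (fst e) - h (snd e)) v
    = (\<Sum>j\<in>neighbors G v. h v - h j)"
proof -
  have "v \<in> C1 \<or> v \<in> C2" using G(2) v unfolding proper_2_coloring_def by blast
  then show ?thesis
  proof
    assume "v \<in> C1"
    then show ?thesis
      unfolding net_flow_def edges_at_source[OF G \<open>v \<in> C1\<close>]
      by (simp add: sum.reindex inj_on_def)
  next
    assume "v \<in> C2"
    then show ?thesis
      unfolding net_flow_def edges_at_sink[OF G \<open>v \<in> C2\<close>]
      by (simp add: sum.reindex inj_on_def sum_negf[symmetric])
  qed
qed

lemma oriented_edges_connected:
  assumes G: "pair_graph G" "proper_2_coloring G C1 C2"
    and conn: "Digraph_Component.connected (with_proj G)"
    and uv: "u \<in> pverts G" "v \<in> pverts G"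
  shows "(u, v) \<in> (oriented_edges G C1 C2 \<union> (oriented_edges G C1 C2)\<inverse>)\<^sup>*"
proof -
  let ?H = "with_proj (mk_symmetric (with_proj G))"
  have "reachable ?H u v"
    using conn uv unfolding connected_def strongly_connected_def by simp
  then have "(u, v) \<in> (parcs (mk_symmetric (with_proj G)))\<^sup>*"
    using reachable_rtranclI[of ?H] by simp
  moreover have "(a, b) \<in> oriented_edges G C1 C2 \<union> (oriented_edges G C1 C2)\<inverse>"
    if "(a, b) \<in> parcs G" for a b
    using arc_between_classes[OF G that] that parcs_symmetric[OF G(1), of a b]
    unfolding oriented_edges_def by blast
  then have "parcs (mk_symmetric (with_proj G))
      \<subseteq> oriented_edges G C1 C2 \<union> (oriented_edges G C1 C2)\<inverse>"
    unfolding parcs_mk_symmetric with_proj_simps by fastforce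
  ultimately show ?thesis using rtrancl_mono by blast
qed

lemma degree_pos:
  assumes "pair_graph G" "proper_2_coloring G C1 C2"
    and "Digraph_Component.connected (with_proj G)"
    and u: "u \<in> pverts G" and w: "w \<in> pverts G" "w \<noteq> u"
  shows "card (neighbors G u) > 0"
proof -
  interpret pair_graph G by fact
  obtain j where "(u, j) \<in> oriented_edges G C1 C2 \<union> (oriented_edges G C1 C2)\<inverse>"
    using oriented_edges_connected[OF assms(1-4) w(1)] w(2) by (metis converse_rtranclE)
  then have "j \<in> neighbors G u"
    using parcs_symmetric[OF assms(1)] by (auto simp: oriented_edges_def neighbors_def)
  moreover have "neighbors G u \<subseteq> pverts G"
    using in_arcsD2 by (auto simp: neighbors_def)
  then have "finite (neighbors G u)"
    using pair_finite_verts finite_subset by blast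
  ultimately show ?thesis using card_gt_0_iff by blast
qed

text \<open>
  Time is shifted so that the zero initial values sit at index 0, where the multipliers start as
  empty sums. The claim behind the optimality conditions is that \<open>\<gamma>\<^sub>v\<close> is the net flow of the
  multipliers out of \<open>v\<close>, which is preserved because both sides grow by \<open>\<rho>\<close> times the
  Laplacian of the current values.
\<close>

lemma dadmm_is_edge_admm:
  fixes A :: "real ^ 'n ^ 'm" and x :: "'v \<Rightarrow> nat \<Rightarrow> real ^ 'n"
  assumes G: "pair_graph G" "proper_2_coloring G C1 C2"
    and conn: "Digraph_Component.connected (with_proj G)"
    and card: "card (pverts G) \<ge> 2"
    and rho: "\<rho> > 0"
    and dadmm: "bipartite_dadmm G C1 C2 A b R \<rho> x \<gamma>"
    and feasible: "\<And>p. p \<in> pverts G \<Longrightarrow> block_solutions A b R p \<noteq> {}"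
  shows "bipartite_consensus_admm (pverts G) (oriented_edges G C1 C2)
    (\<lambda>_ z. 1 / real (card (pverts G)) * l1_norm z) (block_solutions A b R) \<rho>
    (\<lambda>p k. x p (Suc k))
    (\<lambda>e k. \<rho> *\<^sub>R (\<Sum>i<k. x (fst e) (Suc (Suc i)) - x (snd e) (Suc (Suc i))))"
    (is "bipartite_consensus_admm ?V ?E _ _ _ _ ?L")
proof -
  interpret pair_graph G by fact
  have other: "\<exists>w\<in>?V. w \<noteq> u" if "u \<in> ?V" for u
  proof (rule ccontr)
    assume "\<not> ?thesis"
    then have "?V \<subseteq> {u}" by blast
    then have "card ?V \<le> 1" using card_mono[of "{u}" ?V] by simp
    with card show False by simp
  qed
  have deg: "card (neighbors G u) > 0" if "u \<in> ?V" for u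
    using other[OF that] degree_pos[OF G conn that] by blast
  have L_Suc: "?L e (Suc k) = ?L e k + \<rho> *\<^sub>R (x (fst e) (Suc (Suc k)) - x (snd e) (Suc (Suc k)))"
    for e k
    by (simp add: scaleR_add_right)
  have \<gamma>_step: "\<gamma> v (Suc (Suc k)) = \<gamma> v (Suc k)
      + \<rho> *\<^sub>R (\<Sum>j\<in>neighbors G v. x v (Suc (Suc k)) - x j (Suc (Suc k)))"
    if "v \<in> ?V" for v k
    using dadmm that unfolding bipartite_dadmm_def by simp
  have \<gamma>: "\<gamma> v (Suc k) = net_flow ?E (\<lambda>e. ?L e k) v" if v: "v \<in> ?V" for v k
  proof (induction k)
    case 0
    have "\<gamma> v 1 = 0" using dadmm v unfolding bipartite_dadmm_def by blast
    then show ?case by (simp add: net_flow_zero)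
  next
    case (Suc k)
    have "net_flow ?E (\<lambda>e. ?L e (Suc k)) v = net_flow ?E (\<lambda>e. ?L e k) v
        + \<rho> *\<^sub>R net_flow ?E (\<lambda>e. x (fst e) (Suc (Suc k)) - x (snd e) (Suc (Suc k))) v"
      unfolding L_Suc net_flow_add net_flow_scaleR ..
    then show ?case
      unfolding \<gamma>_step[OF v] Suc.IH
      using net_flow_gradient[OF G v, of "\<lambda>u. x u (Suc (Suc k))"] by simp
  qed
  have primal: "tilted_minimizer (\<lambda>z. 1 / real (card ?V) * l1_norm z) (block_solutions A b R v)
      (net_flow ?E (\<lambda>e. ?L e (Suc k)) v
        + \<rho> *\<^sub>R (\<Sum>e | e \<in> ?E \<and> fst e = v. x (snd e) (Suc (Suc k)) - x (snd e) (Suc k)))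
      (x v (Suc (Suc k)))" if v: "v \<in> ?V" for v k
  proof -
    let ?x = "x v (Suc (Suc k))" and ?D = "real (card (neighbors G v))"
    have opt: "tilted_minimizer (\<lambda>z. 1 / real (card ?V) * l1_norm z) (block_solutions A b R v)
        (\<gamma> v (Suc k) - \<rho> *\<^sub>R (\<Sum>j\<in>neighbors G v. y j) + (?D * \<rho>) *\<^sub>R ?x) ?x"
      if "?x = node_update G A b R \<rho> v (\<gamma> v (Suc k) - \<rho> *\<^sub>R (\<Sum>j\<in>neighbors G v. y j))" for y
      using node_update_tilted_minimizer[OF rho deg[OF v] feasible[OF v],
          of "\<gamma> v (Suc k) - \<rho> *\<^sub>R (\<Sum>j\<in>neighbors G v. y j)"]
      unfolding that[symmetric] .
    \<comment> \<open>The slope in \<open>opt\<close> has \<open>y\<close> where this has the new neighbour values.\<close>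
    have \<gamma>': "net_flow ?E (\<lambda>e. ?L e (Suc k)) v
      = \<gamma> v (Suc k) + (?D * \<rho>) *\<^sub>R ?x - \<rho> *\<^sub>R (\<Sum>j\<in>neighbors G v. x j (Suc (Suc k)))"
      unfolding \<gamma>[OF v, symmetric] \<gamma>_step[OF v]
      by (simp add: sum_subtractf scaleR_diff_right sum_constant_scaleR mult.commute del: sum_constant)
    have "v \<in> C1 \<or> v \<in> C2" using G(2) v unfolding proper_2_coloring_def by blast
    then show ?thesis
    proof
      assume C1: "v \<in> C1"
      then have upd: "?x = node_update G A b R \<rho> v
          (\<gamma> v (Suc k) - \<rho> *\<^sub>R (\<Sum>j\<in>neighbors G v. x j (Suc k)))"
        using dadmm unfolding bipartite_dadmm_def by simp
      have drift: "(\<Sum>e | e \<in> ?E \<and> fst e = v. x (snd e) (Suc (Suc k)) - x (snd e) (Suc k))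
        = (\<Sum>j\<in>neighbors G v. x j (Suc (Suc k))) - (\<Sum>j\<in>neighbors G v. x j (Suc k))"
        unfolding edges_at_source[OF G C1] by (simp add: sum.reindex inj_on_def sum_subtractf)
      show ?thesis unfolding \<gamma>' drift using opt[OF upd] by (simp add: algebra_simps)
    next
      assume C2: "v \<in> C2"
      then have upd: "?x = node_update G A b R \<rho> v
          (\<gamma> v (Suc k) - \<rho> *\<^sub>R (\<Sum>j\<in>neighbors G v. x j (Suc (Suc k))))"
        using dadmm unfolding bipartite_dadmm_def by simp
      show ?thesis unfolding \<gamma>' edges_at_sink[OF G C2] using opt[OF upd] by (simp add: algebra_simps)
    qed
  qed
  obtain u where u: "u \<in> ?V" using card by fastforce
  obtain j where j: "(u, j) \<in> parcs G"
    using deg[OF u] unfolding neighbors_def by (metis (no_types, lifting) card.empty empty_Collect_eq less_numeral_extra(3))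
  show ?thesis
  proof
    show "finite ?V" by (rule pair_finite_verts)
    show "?E \<subseteq> ?V \<times> ?V" "Domain ?E \<inter> Range ?E = {}"
      using G(2) unfolding oriented_edges_def proper_2_coloring_def by auto
    show "?E \<noteq> {}"
      using arc_between_classes[OF G j] j parcs_symmetric[OF G(1)] unfolding oriented_edges_def by blast
    show "(u, v) \<in> (?E \<union> ?E\<inverse>)\<^sup>*" if "u \<in> ?V" "v \<in> ?V" for u v
      using oriented_edges_connected[OF G conn that] .
    show "continuous_on UNIV (\<lambda>z :: real ^ 'n. 1 / real (card ?V) * l1_norm z)"
      by (intro continuous_intros continuous_l1_norm)
  qed (use rho closed_block_solutions L_Suc primal in auto)
qed

section \<open>Convergence to a Basis Pursuit solution\<close>

theorem theorem1:
  fixes A :: "real ^ 'n ^ 'm" and b :: "real ^ 'm"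
    and P :: nat and G :: "nat pair_pre_digraph" and C1 C2 :: "nat set"
    and R :: "nat \<Rightarrow> 'm set" and \<rho> :: real
    and x \<gamma> :: "nat \<Rightarrow> nat \<Rightarrow> real ^ 'n"
  assumes "CARD('m) < CARD('n)"
    and "rank A = min CARD('m) CARD('n)"
    and "P \<ge> 2"
    and "pair_graph G" and "pverts G = {1..P}"
    and "Digraph_Component.connected (with_proj G)"
    and "row_partition {1..P} R"
    and "\<rho> > 0"
    and "proper_2_coloring G C1 C2"
    and "bipartite_dadmm G C1 C2 A b R \<rho> x \<gamma>"
  shows "\<forall>p\<in>{1..P}. \<exists>z. bp_solution A b z \<and> (\<lambda>k. x p k) \<longlonglongrightarrow> z"
proof -
  let ?V = "pverts G" and ?E = "oriented_edges G C1 C2"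
  have R: "row_partition ?V R" and V: "finite ?V" "?V \<noteq> {}" "card ?V \<ge> 2"
    using assms(3,5,7) by auto
  have surj: "surj ((*v) A)"
    using assms(1,2) full_rank_surjective[of A] by simp
  obtain z\<^sub>0 where z0: "bp_solution A b z\<^sub>0"
    using bp_solution_exists[OF surj] by blast
  then have "A *v z\<^sub>0 = b" unfolding bp_solution_def is_arg_min_def by blast
  then have feasible: "block_solutions A b R p \<noteq> {}" if "p \<in> ?V" for p
    using feasible_iff_blocks[OF R] that by blast
  interpret bipartite_consensus_admm ?V ?E
    "\<lambda>_ z. 1 / real (card ?V) * l1_norm z" "block_solutions A b R" \<rho> "\<lambda>p k. x p (Suc k)"
    "\<lambda>e k. \<rho> *\<^sub>R (\<Sum>i<k. x (fst e) (Suc (Suc i)) - x (snd e) (Suc (Suc i)))"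
    using dadmm_is_edge_admm[OF assms(4,9,6) V(3) assms(8,10) feasible] by simp
  obtain s where s: "(\<Sum>p\<in>?V. s p) = 0" "\<And>p. p \<in> ?V \<Longrightarrow>
      tilted_minimizer (\<lambda>z. 1 / real (card ?V) * l1_norm z) (block_solutions A b R p) (s p) z\<^sub>0"
    using bp_multipliers_exist[OF V(1,2) R surj z0] by blast
  obtain M\<^sub>0 where "\<And>p. p \<in> ?V \<Longrightarrow> net_flow ?E M\<^sub>0 p = s p"
    using balanced_flow_exists[OF V(1) finite_E connected s(1)] by blast
  then have "saddle z\<^sub>0 M\<^sub>0" using s(2) unfolding saddle_def by simp
  then obtain z M where z: "saddle z M" "\<And>p. p \<in> ?V \<Longrightarrow> (\<lambda>k. x p (Suc k)) \<longlonglongrightarrow> z"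
    using converges_to_saddle by blast
  have "bp_solution A b z"
    using balanced_minimizer_is_bp_solution[OF V(1,2) R sum_net_flow[OF V(1) E_subset, of M]] z(1)
    unfolding saddle_def by blast
  moreover have "x p \<longlonglongrightarrow> z" if "p \<in> ?V" for p
    using z(2)[OF that] by (rule LIMSEQ_imp_Suc)
  ultimately show ?thesis using assms(5) by auto
qed

end
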